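(* Let $q\in(0,1)$. Let $\{A_n\}_{n\ge 1}$ be a sequence of real numbers such that $A_1=1$, and put $B_n=\dfrac{A_n(1-q^n)}{1-q}$ for all $n\ge 1$. Suppose that either $$1\ge B_1+B_2\ge\cdots\ge B_{n-1}+B_n\ge\cdots\ge 0$$ or $$1\le B_1+B_2\le\cdots\le B_{n-1}+B_n\le\cdots\le 2 .$$ Then $f(z)=z+\sum_{n=2}^\infty A_nz^n$ belongs to $\mathcal{K}_q$ with the function $g(z)=z/(1-z^2)$.
   Context: $\mathbb{D}=\{z\in\mathbb{C}:|z|<1\}$. $\mathcal{A}$ is the class of functions $f$ analytic in $\mathbb{D}$ with $f(0)=0=f'(0)-1$. $\mathcal{S}^*\subset\mathcal{A}$ is the class of univalent functions $g\in\mathcal{A}$ that are starlike with respect to the origin ($tw\in g(\mathbb{D})$ whenever $t\in[0,1]$, $w\in g(\mathbb{D})$). For $q\in(0,1)$ and $f\in\mathcal{A}$, the $q$-difference operator is $(D_qf)(z)=\dfrac{f(z)-f(qz)}{z(1-q)}$ for $z\in\mathbb{D}\setminus\{0\}$, and $(D_qf)(0)=f'(0)$. A function $f\in\mathcal{A}$ belongs to $\mathcal{K}_q$ ($q$-close-to-convex functions) if there exists $g\in\mathcal{S}^*$ such that $$\left|\frac{z}{g(z)}(D_qf)(z)-\frac{1}{1-q}\right|\le\frac{1}{1-q},\quad z\in\mathbb{D}$$ (where $z/g(z)$ is given its limit value $1$ at $z=0$); one then says that $f\in\mathcal{K}_q$ with the function $g$. *)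

theory Defs
  imports "HOL-Complex_Analysis.Complex_Analysis"
begin

abbreviation unit_disc :: "complex set" where
  "unit_disc \<equiv> ball 0 1"

definition class_A :: "(complex \<Rightarrow> complex) set" where
  "class_A = {f. f analytic_on unit_disc \<and> f 0 = 0 \<and> deriv f 0 - 1 = 0}"

definition class_S_star :: "(complex \<Rightarrow> complex) set" where
  "class_S_star = {g \<in> class_A. inj_on g unit_disc \<and>
     (\<forall>t::real. \<forall>w. 0 \<le> t \<and> t \<le> 1 \<and> w \<in> g ` unit_disc
        \<longrightarrow> of_real t * w \<in> g ` unit_disc)}"

definition q_diff :: "real \<Rightarrow> (complex \<Rightarrow> complex) \<Rightarrow> complex \<Rightarrow> complex" where
  "q_diff q f z =
     (if z = 0 then deriv f 0
      else (f z - f (of_real q * z)) / (z * (1 - of_real q)))"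

text \<open>The quotient \<open>z / g z\<close>, with its limit value 1 at the removable singularity 0
  (in HOL, \<open>0 / g 0 = 0\<close>).\<close>

definition id_quot :: "(complex \<Rightarrow> complex) \<Rightarrow> complex \<Rightarrow> complex" where
  "id_quot g z = (if z = 0 then 1 else z / g z)"

definition q_close_to_convex_with ::
  "real \<Rightarrow> (complex \<Rightarrow> complex) \<Rightarrow> (complex \<Rightarrow> complex) \<Rightarrow> bool" where
  "q_close_to_convex_with q f g \<longleftrightarrow> f \<in> class_A \<and> g \<in> class_S_star \<and>
     (\<forall>z\<in>unit_disc.
        norm (id_quot g z * q_diff q f z - 1 / (1 - of_real q)) \<le> 1 / (1 - q))"

definition class_K :: "real \<Rightarrow> (complex \<Rightarrow> complex) set" where
  "class_K q = {f. \<exists>g. q_close_to_convex_with q f g}"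

end

theory Submission
  imports Defs
begin

text \<open>
  Put \<open>B n = A n (1 - q\<^sup>n) / (1 - q)\<close>, also for \<open>n = 0\<close>, where it vanishes, so that
  \<open>D\<^sub>q f z = (\<Sum>n. B (n + 1) z\<^sup>n)\<close>. For \<open>g z = z / (1 - z\<^sup>2)\<close> the quotient \<open>z / g z\<close>
  factors as \<open>(1 - z) (1 + z)\<close>, and the two factors act on coefficients in turn.
  Multiplication by \<open>1 + z\<close> turns the coefficients of \<open>D\<^sub>q f\<close> into the sums
  \<open>d n = B n + B (n + 1)\<close>, with \<open>d 0 = 1\<close>, and multiplication by \<open>1 - z\<close> turns these into
  differences:
  \<open>(z / g z) D\<^sub>q f z = 1 + (\<Sum>n. (d (n + 1) - d n) z ^ (n + 1))\<close>.
  In both cases of the hypothesis \<open>d\<close> is monotone and stays within distance 1 of \<open>d 0\<close>. By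
  telescoping, the absolute values of the differences add up to at most 1, so the expression lies
  in the closed disc of radius 1 about 1 (\<open>monotone_coefficients_bound\<close>). As \<open>1 / (1 - q) \<ge> 1\<close>,
  that disc is contained in the closed disc of radius \<open>1 / (1 - q)\<close> about \<open>1 / (1 - q)\<close>: both
  touch the imaginary axis at 0.

  Convergence of the series is a by-product: \<open>d\<close> is bounded, hence \<open>B\<close>, and with it \<open>A\<close>,
  grows at most linearly.

  That \<open>g\<close> is starlike is seen from \<open>1 / g z = 1 / z - z\<close>. This map sends the punctured disc
  onto the complement of the segment from \<open>-2\<i>\<close> to \<open>2\<i>\<close>, and that complement is closed under
  multiplication by \<open>1 / t\<close> for \<open>0 < t \<le> 1\<close>.
\<close>

section \<open>Normalized functions\<close>

text \<open>Writing \<open>F\<close> as \<open>z * h z\<close> moves the normalization \<open>F' 0 = 1\<close> to a value of \<open>h\<close>, so no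
  derivative of a power series or of a quotient has to be computed.\<close>

lemma class_A_I:
  assumes h: "h holomorphic_on unit_disc" and "h 0 = 1"
    and F: "\<And>z. z \<in> unit_disc \<Longrightarrow> F z = z * h z"
  shows "F \<in> class_A"
proof -
  have "(\<lambda>z. z * h z) holomorphic_on unit_disc"
    by (intro holomorphic_intros h)
  then have "F holomorphic_on unit_disc"
    by (rule holomorphic_transform) (simp add: F)
  moreover have "(F has_field_derivative 1) (at 0)"
  proof (rule has_field_derivative_transform_within_open[where S = unit_disc])
    have "h field_differentiable at 0"
      using h by (rule holomorphic_on_imp_differentiable_at) auto
    then obtain h' where "(h has_field_derivative h') (at 0)"
      by (auto simp: field_differentiable_def)
    then show "((\<lambda>z. z * h z) has_field_derivative 1) (at 0)"
      using \<open>h 0 = 1\<close> by (auto intro!: derivative_eq_intros)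
  qed (auto simp: F)
  ultimately show ?thesis
    by (auto simp: class_A_def analytic_on_open F DERIV_imp_deriv)
qed

section \<open>Starlikeness of the comparison function\<close>

text \<open>As \<open>1 / z\<close> is \<open>cnj z\<close> scaled by \<open>1 / \<bar>z\<bar>\<^sup>2 > 1\<close>, the real part of \<open>1 / z - z\<close> can only
  vanish together with \<open>Re z\<close>; on the imaginary axis the claim is \<open>1 / y + y > 2\<close> for
  \<open>0 < y < 1\<close>.\<close>

lemma Im_inverse_minus_self_gt_2:
  assumes "norm z < 1" and "z \<noteq> 0" and "Re (1 / z - z) = 0"
  shows "\<bar>Im (1 / z - z)\<bar> > 2"
proof -
  let ?n = "(norm z)\<^sup>2"
  have n: "0 < ?n" "?n < 1"
    using assms by (auto simp: power_less_one_iff abs_square_less_1)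
  have "1 / z = cnj z / of_real ?n"
    using assms(2) complex_norm_square[of z] by (simp add: field_simps)
  then have re: "Re (1 / z - z) = Re z * (1 / ?n - 1)"
    and im: "Im (1 / z - z) = - (Im z * (1 / ?n + 1))"
    by (simp_all add: field_simps)
  have "1 / ?n > 1" using n by simp
  then have "1 / ?n - 1 \<noteq> 0" by linarith
  with re assms(3) have "Re z = 0" by (metis mult_eq_0_iff)
  define y where "y = \<bar>Im z\<bar>"
  have y: "y = norm z" using \<open>Re z = 0\<close> by (simp add: y_def cmod_def)
  have "0 < (1 - y)\<^sup>2" using assms(1) y by simp
  then have "2 * y < 1 + y\<^sup>2" by (simp add: power2_eq_square algebra_simps)
  moreover have "0 < y" using assms(2) y by simp
  ultimately have "2 < (1 + y\<^sup>2) / y"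
    by (simp add: pos_less_divide_eq)
  also have "\<dots> = y * (1 / y\<^sup>2 + 1)"
    using \<open>0 < y\<close> by (simp add: field_simps power2_eq_square)
  finally have "2 < y * (1 / y\<^sup>2 + 1)" .
  moreover have "\<bar>Im (1 / z - z)\<bar> = y * (1 / y\<^sup>2 + 1)"
    unfolding im y_def[symmetric] y[symmetric] by (simp add: abs_mult y_def[symmetric])
  ultimately show ?thesis by simp
qed

text \<open>The equation \<open>1 / z - z = v\<close> is a quadratic one whose roots are \<open>x\<close> and \<open>- 1 / x\<close>. One of
  them lies in the open disc unless both lie on the circle, where \<open>v = cnj x - x\<close> is on the
  excluded segment.\<close>

lemma inverse_minus_self_attained:
  assumes "Re v = 0 \<Longrightarrow> \<bar>Im v\<bar> > 2"
  obtains z where "norm z < 1" and "z \<noteq> 0" and "1 / z - z = v"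
proof -
  define x where "x = (csqrt (v\<^sup>2 + 4) - v) / 2"
  have "2 * x + v = csqrt (v\<^sup>2 + 4)"
    unfolding x_def by (simp only: nonzero_mult_div_cancel_left times_divide_eq_right
        zero_neq_numeral[symmetric] not_False_eq_True diff_add_cancel)
  then have "(2 * x + v)\<^sup>2 = v\<^sup>2 + 4"
    by simp
  then have "4 * (x * x + v * x - 1) = 0"
    by (simp add: power2_eq_square algebra_simps)
  then have quad: "x * x + v * x = 1"
    unfolding mult_eq_0_iff by simp
  then have "x \<noteq> 0" by auto
  with quad have v: "1 / x - x = v"
    by (simp add: field_simps)
  consider "norm x < 1" | "norm x > 1" | "norm x = 1" by linarith
  then show ?thesis
  proof cases
    case 1
    with v \<open>x \<noteq> 0\<close> that show ?thesis by blast
  next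
    case 2
    have "1 / (- 1 / x) - (- 1 / x) = v"
      using v by simp
    moreover have "norm (- 1 / x) < 1"
      using 2 by (auto simp: norm_divide divide_less_eq)
    ultimately show ?thesis
      using that[of "- 1 / x"] \<open>x \<noteq> 0\<close> by simp
  next
    case 3
    then have "1 / x = cnj x"
      using \<open>x \<noteq> 0\<close> complex_norm_square[of x] by (simp add: field_simps)
    then have "v = cnj x - x" using v by simp
    then have "Re v = 0" and "\<bar>Im v\<bar> \<le> 2"
      using 3 abs_Im_le_cmod[of x] by simp_all
    with assms show ?thesis by simp
  qed
qed

text \<open>Scaling \<open>w\<close> by \<open>t \<le> 1\<close> scales \<open>1 / w\<close> by \<open>1 / t \<ge> 1\<close>, which keeps it off the segment that
  \<open>1 / z - z\<close> omits. Injectivity holds because the two roots of the quadratic equation have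
  product \<open>-1\<close>, so that the disc contains at most one of them.\<close>

lemma starlike_z_over_one_minus_z_square:
  assumes g: "\<And>z. z \<in> unit_disc \<Longrightarrow> g z = z / (1 - z\<^sup>2)"
  shows "g \<in> class_S_star"
proof -
  have ne: "1 - z\<^sup>2 \<noteq> 0" if "z \<in> unit_disc" for z :: complex
  proof
    assume "1 - z\<^sup>2 = 0"
    then have "norm (z\<^sup>2) = 1" by simp
    then have "(norm z)\<^sup>2 = 1" by (simp add: norm_power)
    then have "norm z = 1"
      unfolding power2_eq_1_iff using norm_ge_zero[of z] by linarith
    with that show False by simp
  qed
  have g_inv: "1 / g z = 1 / z - z" if "z \<in> unit_disc" "z \<noteq> 0" for z
    using that ne[OF that(1)] by (simp add: g field_simps power2_eq_square)
  have "g \<in> class_A"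
    by (rule class_A_I[where h = "\<lambda>z. 1 / (1 - z\<^sup>2)"])
       (auto simp: g intro!: holomorphic_intros dest: ne)
  moreover have "inj_on g unit_disc"
  proof (rule inj_onI)
    fix x y assume xy: "x \<in> unit_disc" "y \<in> unit_disc" "g x = g y"
    then have "x * (1 - y\<^sup>2) = y * (1 - x\<^sup>2)"
      using ne[OF xy(1)] ne[OF xy(2)] by (simp add: g field_simps)
    then have "(x - y) * (1 + x * y) = 0"
      by (simp add: algebra_simps power2_eq_square)
    moreover have "1 + x * y \<noteq> 0"
    proof
      assume "1 + x * y = 0"
      then have "x * y = - 1" by (simp add: eq_neg_iff_add_eq_0 add.commute)
      then have "norm x * norm y = 1" by (metis norm_minus_cancel norm_mult norm_one)
      moreover have "norm x * norm y < 1 * 1"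
        using xy by (intro mult_strict_mono) auto
      ultimately show False by simp
    qed
    ultimately show "x = y" by simp
  qed
  moreover have "of_real t * w \<in> g ` unit_disc"
    if t: "0 \<le> t" "t \<le> 1" and w: "w \<in> g ` unit_disc" for t :: real and w
  proof -
    obtain z where z: "z \<in> unit_disc" "w = g z" using w by auto
    show ?thesis
    proof (cases "t = 0 \<or> z = 0")
      case True
      then have "of_real t * w = g 0" using z by (auto simp: g)
      then show ?thesis by (metis centre_in_ball imageI zero_less_one)
    next
      case False
      \<comment> \<open>A preimage of \<open>t w\<close> under \<open>g\<close> is a solution \<open>x\<close> of \<open>1 / x - x = 1 / (t w)\<close>.\<close>
      define v where "v = (1 / z - z) / of_real t"
      have "t > 0" using False t by simp
      have "\<bar>Im v\<bar> > 2" if "Re v = 0"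
      proof -
        have "Re (1 / z - z) = 0"
          using that \<open>t > 0\<close> by (simp add: v_def)
        then have "2 < \<bar>Im (1 / z - z)\<bar>"
          using Im_inverse_minus_self_gt_2[of z] z False by simp
        also have "\<dots> = t * \<bar>Im v\<bar>"
          using \<open>t > 0\<close> by (simp add: v_def)
        also have "\<dots> \<le> 1 * \<bar>Im v\<bar>"
          using t by (intro mult_right_mono) auto
        finally show ?thesis by simp
      qed
      then obtain x where x: "norm x < 1" "x \<noteq> 0" "1 / x - x = v"
        by (rule inverse_minus_self_attained)
      have "1 / g x = 1 / (of_real t * w)"
      proof -
        have "1 / g x = (1 / z - z) / of_real t"
          using g_inv[of x] x by (simp add: v_def)
        also have "\<dots> = (1 / w) / of_real t"
          using g_inv[of z] z False by simp
        finally show ?thesis by (simp add: mult.commute)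
      qed
      then have "g x = of_real t * w"
        by (metis div_by_1 divide_divide_eq_right mult_1)
      with x show ?thesis by (metis image_eqI mem_ball_0)
    qed
  qed
  ultimately show ?thesis by (auto simp: class_S_star_def)
qed

section \<open>Power series with monotone coefficients\<close>

lemma summable_linear_growth:
  fixes a :: "nat \<Rightarrow> real" and z :: complex
  assumes "\<And>n. \<bar>a n\<bar> \<le> C * real (Suc n)" and "norm z < 1"
  shows "summable (\<lambda>n. of_real (a n) * z ^ n)"
proof (rule summable_comparison_test')
  show "summable (\<lambda>n. C * (real (Suc n) * norm z ^ n))"
    using geometric_deriv_sums[of "norm z"] assms(2)
    by (intro summable_mult) (auto simp: sums_iff)
  show "norm (of_real (a n) * z ^ n) \<le> C * (real (Suc n) * norm z ^ n)" for n
    using mult_right_mono[OF assms(1)[of n], of "norm z ^ n"]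
    by (simp add: norm_mult norm_power mult.assoc)
qed

text \<open>Multiplying by \<open>1 - z\<close> produces a series whose coefficients are the differences of \<open>d\<close>. They
  all have the same sign, so the sum of their absolute values telescopes to \<open>\<bar>d N - d 0\<bar>\<close>.\<close>

lemma monotone_coefficients_bound:
  fixes d :: "nat \<Rightarrow> real" and z S :: complex
  assumes "monoseq d" and bound: "\<And>n. \<bar>d n - d 0\<bar> \<le> r" and "norm z < 1"
    and S: "(\<lambda>n. of_real (d n) * z ^ n) sums S"
  shows "norm ((1 - z) * S - of_real (d 0)) \<le> r"
proof -
  have shift: "(\<lambda>n. of_real (d (Suc n)) * z ^ Suc n) sums (S - of_real (d 0))"
    using S by (subst sums_Suc_iff) simp
  have "(\<lambda>n. of_real (d (Suc n)) * z ^ Suc n - z * (of_real (d n) * z ^ n))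
      sums (S - of_real (d 0) - z * S)"
    by (intro sums_diff shift sums_mult S)
  then have lim: "(\<lambda>N. \<Sum>n<N. of_real (d (Suc n) - d n) * z ^ Suc n)
      \<longlonglongrightarrow> (1 - z) * S - of_real (d 0)"
    by (simp add: sums_def algebra_simps)
  have "norm (\<Sum>n<N. of_real (d (Suc n) - d n) * z ^ Suc n) \<le> r" for N
  proof -
    have "norm (\<Sum>n<N. of_real (d (Suc n) - d n) * z ^ Suc n)
        \<le> (\<Sum>n<N. \<bar>d (Suc n) - d n\<bar>)"
    proof (rule sum_norm_le)
      fix n
      have "norm (z ^ Suc n) \<le> 1"
        using assms(3) by (simp only: norm_power power_le_one norm_ge_zero less_imp_le)
      then have "\<bar>d (Suc n) - d n\<bar> * norm (z ^ Suc n) \<le> \<bar>d (Suc n) - d n\<bar> * 1"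
        by (intro mult_left_mono) auto
      then show "norm (of_real (d (Suc n) - d n) * z ^ Suc n) \<le> \<bar>d (Suc n) - d n\<bar>"
        by (simp only: norm_mult norm_of_real mult_1_right)
    qed
    also have "\<dots> = \<bar>d N - d 0\<bar>"
      using \<open>monoseq d\<close> unfolding monoseq_Suc
    proof
      assume *: "\<forall>n. d n \<le> d (Suc n)"
      then have "mono d" by (simp add: mono_iff_le_Suc)
      then have "d 0 \<le> d N" by (auto dest: monoD)
      with * show ?thesis by (simp add: sum_lessThan_telescope)
    next
      assume *: "\<forall>n. d (Suc n) \<le> d n"
      then have "decseq d" by (simp add: decseq_Suc_iff)
      then have "d N \<le> d 0" by (auto dest: decseqD)
      moreover have "\<bar>d (Suc n) - d n\<bar> = d n - d (Suc n)" for n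
        using * by simp
      ultimately show ?thesis by (simp add: sum_lessThan_telescope')
    qed
    also have "\<dots> \<le> r" by (rule bound)
    finally show ?thesis .
  qed
  then show ?thesis
    by (intro Lim_bounded[OF tendsto_norm[OF lim], of 0]) blast
qed

section \<open>The q-difference operator on power series\<close>

lemma q_diff_sums:
  fixes A :: "nat \<Rightarrow> real" and F h :: "complex \<Rightarrow> complex"
  assumes "0 < q" "q < 1" "z \<in> unit_disc" "z \<noteq> 0"
    and h: "\<And>w. w \<in> unit_disc \<Longrightarrow> (\<lambda>n. of_real (A (Suc n)) * w ^ n) sums h w"
    and F: "\<And>w. w \<in> unit_disc \<Longrightarrow> F w = w * h w"
  shows "(\<lambda>n. of_real (A (Suc n) * (1 - q ^ Suc n) / (1 - q)) * z ^ n) sums q_diff q F z"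
proof -
  have "norm (of_real q * z) \<le> norm z"
    using assms(1,2) by (simp add: norm_mult mult_left_le_one_le)
  then have qz: "of_real q * z \<in> unit_disc"
    using assms(3) by simp
  have "(\<lambda>n. (of_real (A (Suc n)) * z ^ n - of_real q * (of_real (A (Suc n)) * (of_real q * z) ^ n))
        / (1 - of_real q)) sums ((h z - of_real q * h (of_real q * z)) / (1 - of_real q))"
    by (intro sums_divide sums_diff sums_mult h qz assms(3))
  also have "(h z - of_real q * h (of_real q * z)) / (1 - of_real q) = q_diff q F z"
  proof -
    have "q_diff q F z = (z * (h z - of_real q * h (of_real q * z))) / (z * (1 - of_real q))"
      using assms(4) by (simp add: q_diff_def F[OF assms(3)] F[OF qz]
          right_diff_distrib mult.assoc mult.left_commute)
    then show ?thesis using assms(4) by simp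
  qed
  finally show ?thesis
    by (simp add: power_mult_distrib algebra_simps)
qed

section \<open>The coefficient condition\<close>

theorem theorem2p8:
  fixes q :: real and A B :: "nat \<Rightarrow> real" and f g :: "complex \<Rightarrow> complex"
  assumes q: "0 < q" "q < 1"
    and A1: "A 1 = 1"
    and B: "\<And>n. n \<ge> 1 \<Longrightarrow> B n = A n * (1 - q ^ n) / (1 - q)"
    and cond:
      "(1 \<ge> B 1 + B 2 \<and>
        (\<forall>n\<ge>1. B n + B (n + 1) \<ge> B (n + 1) + B (n + 2)) \<and>
        (\<forall>n\<ge>1. B n + B (n + 1) \<ge> 0))
       \<or>
       (1 \<le> B 1 + B 2 \<and>
        (\<forall>n\<ge>1. B n + B (n + 1) \<le> B (n + 1) + B (n + 2)) \<and>
        (\<forall>n\<ge>1. B n + B (n + 1) \<le> 2))"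
    and f: "\<And>z. z \<in> unit_disc \<Longrightarrow>
              f z = z + (\<Sum>n. of_real (A (n + 2)) * z ^ (n + 2))"
    and g: "\<And>z. z \<in> unit_disc \<Longrightarrow> g z = z / (1 - z\<^sup>2)"
  shows "(\<forall>z\<in>unit_disc. summable (\<lambda>n. of_real (A (n + 2)) * z ^ (n + 2))) \<and>
         f \<in> class_K q \<and> q_close_to_convex_with q f g"
proof -
  \<comment> \<open>\<open>b\<close> agrees with \<open>B\<close> from index 1 on and has \<open>b 0 = 0\<close>, whereas \<open>B 0\<close> is arbitrary; this
    makes \<open>d 0 = 1\<close>, the outermost bound in both chains of inequalities.\<close>
  define b where "b n = A n * (1 - q ^ n) / (1 - q)" for n
  define d where "d n = b n + b (Suc n)" for n
  have b0: "b 0 = 0" and b1: "b 1 = 1"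
    using q A1 by (simp_all add: b_def)
  then have d0: "d 0 = 1" by (simp add: d_def)
  have dB: "d n = B n + B (n + 1)" if "n \<ge> 1" for n
    using that by (simp add: d_def b_def B)
  have "(\<forall>n. d (Suc n) \<le> d n) \<and> (\<forall>n. 0 \<le> d n) \<or> (\<forall>n. d n \<le> d (Suc n)) \<and> (\<forall>n. d n \<le> 2)"
    using cond
  proof
    assume *: "1 \<ge> B 1 + B 2 \<and>
        (\<forall>n\<ge>1. B n + B (n + 1) \<ge> B (n + 1) + B (n + 2)) \<and>
        (\<forall>n\<ge>1. B n + B (n + 1) \<ge> 0)"
    have "d (Suc n) \<le> d n" for n
      using * d0 dB[of 1] dB[of n] dB[of "Suc n"]
      by (cases n) (auto simp: numeral_2_eq_2)
    moreover have "0 \<le> d n" for n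
      using * d0 dB[of n] by (cases n) auto
    ultimately show ?thesis by blast
  next
    assume *: "1 \<le> B 1 + B 2 \<and>
        (\<forall>n\<ge>1. B n + B (n + 1) \<le> B (n + 1) + B (n + 2)) \<and>
        (\<forall>n\<ge>1. B n + B (n + 1) \<le> 2)"
    have "d n \<le> d (Suc n)" for n
      using * d0 dB[of 1] dB[of n] dB[of "Suc n"]
      by (cases n) (auto simp: numeral_2_eq_2)
    moreover have "d n \<le> 2" for n
      using * d0 dB[of n] by (cases n) auto
    ultimately show ?thesis by blast
  qed
  then have mono: "monoseq d" and range: "\<And>n. \<bar>d n - d 0\<bar> \<le> 1"
  proof -
    assume *: "(\<forall>n. d (Suc n) \<le> d n) \<and> (\<forall>n. 0 \<le> d n) \<or> (\<forall>n. d n \<le> d (Suc n)) \<and> (\<forall>n. d n \<le> 2)"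
    then show "monoseq d" by (auto simp: monoseq_Suc)
    have "d n \<le> d 0 \<and> 0 \<le> d n \<or> d 0 \<le> d n \<and> d n \<le> 2" for n
      using * lift_Suc_mono_le[of d 0 n] lift_Suc_antimono_le[of d 0 n] by blast
    then show "\<bar>d n - d 0\<bar> \<le> 1" for n
      using d0 by (smt (verit))
  qed

  have b_bound: "\<bar>b n\<bar> \<le> 2 * real n" for n
  proof (induction n)
    case (Suc n)
    have "b (Suc n) = d n - b n" by (simp add: d_def)
    with Suc range[of n] d0 show ?case by simp
  qed (simp add: b0)
  \<comment> \<open>Passing from \<open>b n\<close> to \<open>A n\<close> divides by \<open>1 + q + \<dots> + q ^ (n - 1) \<ge> 1\<close>.\<close>
  have "\<bar>A (Suc n)\<bar> \<le> 2 * real (Suc n)" for n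
  proof -
    have "q ^ Suc n \<le> q" using q by (simp add: power_le_one mult_left_le)
    then have "1 \<le> (1 - q ^ Suc n) / (1 - q)" using q by simp
    then have "\<bar>A (Suc n)\<bar> * 1 \<le> \<bar>A (Suc n)\<bar> * ((1 - q ^ Suc n) / (1 - q))"
      by (intro mult_left_mono) auto
    also have "\<dots> = \<bar>b (Suc n)\<bar>"
      using q \<open>q ^ Suc n \<le> q\<close> by (simp add: b_def abs_mult del: power_Suc)
    finally show ?thesis using b_bound[of "Suc n"] by linarith
  qed
  then have A_summable: "summable (\<lambda>n. of_real (A (Suc n)) * z ^ n)"
    if "z \<in> unit_disc" for z :: complex
    using that by (intro summable_linear_growth[where C = 2]) auto

  define h where "h z = (\<Sum>n. of_real (A (Suc n)) * z ^ n)" for z :: complex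
  have h: "(\<lambda>n. of_real (A (Suc n)) * z ^ n) sums h z" if "z \<in> unit_disc" for z
    unfolding h_def using A_summable[OF that] by (rule summable_sums)
  have tail: "(\<lambda>n. of_real (A (n + 2)) * z ^ (n + 2)) sums (z * h z - z)"
    if "z \<in> unit_disc" for z
  proof -
    have "(\<lambda>n. of_real (A (Suc (Suc n))) * z ^ Suc n) sums (h z - 1)"
      using h[OF that] A1 by (subst sums_Suc_iff) simp
    from sums_mult[OF this, of z] show ?thesis
      by (simp add: algebra_simps)
  qed
  have fh: "f z = z * h z" if "z \<in> unit_disc" for z
    using f[OF that] tail[OF that] by (simp add: sums_iff)
  have "h 0 = 1"
    using A1 by (simp add: h_def powser_zero)
  moreover have "h holomorphic_on unit_disc"
    using power_series_holomorphic[of 0 1 "\<lambda>n. of_real (A (Suc n))" h] h by simp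
  ultimately have "f \<in> class_A"
    using fh class_A_I by blast

  moreover have "g \<in> class_S_star"
    using g by (rule starlike_z_over_one_minus_z_square)

  moreover have "norm (id_quot g z * q_diff q f z - 1 / (1 - of_real q)) \<le> 1 / (1 - q)"
    if z: "z \<in> unit_disc" for z
  proof -
    have near_1: "norm (id_quot g z * q_diff q f z - 1) \<le> 1"
    proof (cases "z = 0")
      case True
      then show ?thesis
        using \<open>f \<in> class_A\<close> by (simp add: id_quot_def q_diff_def class_A_def)
    next
      case False
      let ?D = "q_diff q f z"
      have D: "(\<lambda>n. of_real (b (Suc n)) * z ^ n) sums ?D"
        unfolding b_def using q z False h fh by (rule q_diff_sums)
      then have "(\<lambda>n. of_real (b (Suc n)) * z ^ Suc n) sums (z * ?D)"
        using sums_mult[OF D, of z] by (simp add: algebra_simps)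
      then have "(\<lambda>n. of_real (b n) * z ^ n) sums (z * ?D)"
        by (subst (asm) sums_Suc_iff) (simp add: b0)
      from sums_add[OF this D] have "(\<lambda>n. of_real (d n) * z ^ n) sums ((1 + z) * ?D)"
        by (simp add: d_def algebra_simps)
      then have "norm ((1 - z) * ((1 + z) * ?D) - of_real (d 0)) \<le> 1"
        using mono range z by (intro monotone_coefficients_bound) auto
      moreover have "id_quot g z = 1 - z\<^sup>2"
        using False z by (simp add: id_quot_def g)
      then have "id_quot g z = (1 - z) * (1 + z)"
        by (simp add: power2_eq_square algebra_simps)
      ultimately show ?thesis by (simp add: d0 mult.assoc)
    qed
    \<comment> \<open>The disc of radius 1 about 1 lies in the disc of radius \<open>1 / (1 - q)\<close> about \<open>1 / (1 - q)\<close>.\<close>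
    have "1 / (1 - q) \<ge> 1" using q by simp
    then have "norm (1 - 1 / (1 - complex_of_real q)) = 1 / (1 - q) - 1"
      using norm_of_real[of "1 - 1 / (1 - q)", where 'a = complex] by simp
    with near_1 norm_triangle_ineq[of "id_quot g z * q_diff q f z - 1" "1 - 1 / (1 - of_real q)"]
    show ?thesis by simp
  qed
  ultimately have "q_close_to_convex_with q f g"
    by (auto simp: q_close_to_convex_with_def)
  then show ?thesis
    using tail by (auto simp: class_K_def sums_iff)
qed

end
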